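(* Let $C^1,C^2$ be independent Cauchy processes. For all $t>0$ the following identities in distribution hold: $$C^1(|C^2(t)|)\stackrel{i.d.}{=}\frac{1}{2\,C^1\left(\frac{1}{\sqrt{2t}}\right)C^2\left(\frac{1}{\sqrt{2t}}\right)}\qquad\text{and}\qquad C^1(|C^2(t)|)\stackrel{i.d.}{=}\frac{1}{C^1\left(\left|C^2\left(\frac1t\right)\right|\right)} .$$
   Context: The Cauchy process $C(t)$, $t>0$, is the process whose law at time $t$ has density $\frac{t}{\pi(t^2+x^2)}$, $x\in\mathbb{R}$ (standard symmetric Cauchy Lévy process). $X(t)\stackrel{i.d.}{=}Y(t)$ means that, for each fixed $t$, the random variables $X(t)$ and $Y(t)$ have the same law (equality of one-dimensional distributions). *)

theory Defs
  imports "HOL-Probability.Probability"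
begin

(* Processes are indexed by real; only times t >= 0 are constrained. *)

definition cadlag :: "(real \<Rightarrow> real) \<Rightarrow> bool" where
  "cadlag x \<longleftrightarrow>
     (\<forall>t\<ge>0. continuous (at_right t) x) \<and> (\<forall>t>0. \<exists>l. (x \<longlongrightarrow> l) (at_left t))"

(* All sample paths are cadlag (the usual choice of version). Such a path property is needed
   for a process evaluated at a random time to be a random variable at all. *)
locale levy_process = prob_space M for M :: "'a measure" +
  fixes X :: "real \<Rightarrow> 'a \<Rightarrow> real"
  assumes random_variable: "\<And>t. t \<ge> 0 \<Longrightarrow> random_variable borel (X t)"
    and start_zero: "AE \<omega> in M. X 0 \<omega> = 0"
    and independent_increments:
      "\<And>(n::nat) (t::nat \<Rightarrow> real). 0 \<le> t 0 \<Longrightarrow> (\<And>i. i < n \<Longrightarrow> t i < t (Suc i)) \<Longrightarrow>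
         indep_vars (\<lambda>_. borel) (\<lambda>i \<omega>. X (t (Suc i)) \<omega> - X (t i) \<omega>) {..<n}"
    and stationary_increments:
      "\<And>s h. 0 \<le> s \<Longrightarrow> 0 \<le> h \<Longrightarrow>
         distr M borel (\<lambda>\<omega>. X (s + h) \<omega> - X s \<omega>) = distr M borel (X h)"
    and cadlag_paths: "\<And>\<omega>. \<omega> \<in> space M \<Longrightarrow> cadlag (\<lambda>t. X t \<omega>)"

locale cauchy_process = levy_process M X for M :: "'a measure" and X :: "real \<Rightarrow> 'a \<Rightarrow> real" +
  assumes cauchy_law:
    "\<And>t. t > 0 \<Longrightarrow> distributed M lborel (X t) (\<lambda>x. ennreal (t / (pi * (t\<^sup>2 + x\<^sup>2))))"

definition indep_processes ::
    "'a measure \<Rightarrow> (real \<Rightarrow> 'a \<Rightarrow> real) \<Rightarrow> (real \<Rightarrow> 'a \<Rightarrow> real) \<Rightarrow> bool" where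
  "indep_processes M X Y \<longleftrightarrow>
     prob_space.indep_var M
       (PiM {0..} (\<lambda>_. borel)) (\<lambda>\<omega>. \<lambda>t\<in>{0..}. X t \<omega>)
       (PiM {0..} (\<lambda>_. borel)) (\<lambda>\<omega>. \<lambda>t\<in>{0..}. Y t \<omega>)"

(* Equality of one-dimensional distributions. Measurability is part of the claim because
   distr is not meaningful for non-measurable maps. *)
definition eq_id ::
    "'a measure \<Rightarrow> (real \<Rightarrow> 'a \<Rightarrow> real) \<Rightarrow> (real \<Rightarrow> 'a \<Rightarrow> real) \<Rightarrow> bool" where
  "eq_id M X Y \<longleftrightarrow>
     (\<forall>t>0. X t \<in> borel_measurable M \<and> Y t \<in> borel_measurable M \<and>
        distr M borel (X t) = distr M borel (Y t))"

end

theory Submission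
  imports Defs
begin

text \<open>Let \<open>K\<^sub>1\<close>, \<open>K\<^sub>2\<close> be independent standard Cauchy variables. Since \<open>C\<^sup>1(s)\<close> has the law of
  \<open>s K\<^sub>1\<close>, conditioning on the independent time shows that \<open>C\<^sup>1(\<bar>C\<^sup>2(t)\<bar>)\<close> has the law of
  \<open>t K\<^sub>2 K\<^sub>1\<close>. The law of \<open>K\<close> is invariant under \<open>x \<mapsto> 1/x\<close>, so both right-hand sides, being
  reciprocals of multiples of such products, have the same law. The conditioning
  is elementary for a discrete random time; the general time is approximated by discrete ones from
  the right, where the paths are continuous.\<close>

section \<open>Independence and conditioning for variables of different types\<close>

text \<open>The library's \<^const>\<open>prob_space.indep_var\<close> forces both variables to have the same value
  type; a random time and a sample path do not.\<close>
definition (in prob_space) indep_rv where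
  "indep_rv N1 X N2 Y \<longleftrightarrow> random_variable N1 X \<and> random_variable N2 Y \<and>
     distr M (N1 \<Otimes>\<^sub>M N2) (\<lambda>\<omega>. (X \<omega>, Y \<omega>)) = distr M N1 X \<Otimes>\<^sub>M distr M N2 Y"

lemma (in prob_space) indep_var_imp_indep_rv: "indep_var N1 X N2 Y \<Longrightarrow> indep_rv N1 X N2 Y"
  by (auto simp: indep_var_distribution_eq indep_rv_def)

text \<open>A product of image measures is the image of the product measure under the product map.
  This passes from independent paths to single coordinates and to discretised times.\<close>

lemma (in prob_space) indep_rv_compose:
  assumes "indep_rv N1 X N2 Y" and [measurable]: "f \<in> N1 \<rightarrow>\<^sub>M L1" "g \<in> N2 \<rightarrow>\<^sub>M L2"
  shows "indep_rv L1 (\<lambda>\<omega>. f (X \<omega>)) L2 (\<lambda>\<omega>. g (Y \<omega>))"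
proof -
  have [measurable]: "random_variable N1 X" "random_variable N2 Y"
    and joint: "distr M (N1 \<Otimes>\<^sub>M N2) (\<lambda>\<omega>. (X \<omega>, Y \<omega>)) = distr M N1 X \<Otimes>\<^sub>M distr M N2 Y"
    using assms(1) by (auto simp: indep_rv_def)
  interpret G: prob_space "distr (distr M N2 Y) L2 g"
    by (intro prob_space.prob_space_distr prob_space_distr) simp_all
  have "distr M (L1 \<Otimes>\<^sub>M L2) (\<lambda>\<omega>. (f (X \<omega>), g (Y \<omega>))) =
      distr (distr M (N1 \<Otimes>\<^sub>M N2) (\<lambda>\<omega>. (X \<omega>, Y \<omega>))) (L1 \<Otimes>\<^sub>M L2) (\<lambda>(x, y). (f x, g y))"
    by (simp add: distr_distr comp_def)
  also have "\<dots> = distr (distr M N1 X) L1 f \<Otimes>\<^sub>M distr (distr M N2 Y) L2 g"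
    unfolding joint by (rule pair_measure_distr[symmetric]) (simp_all add: G.sigma_finite_measure_axioms)
  finally show ?thesis
    by (simp add: indep_rv_def distr_distr comp_def)
qed

lemma (in prob_space) indep_rv_commute:
  assumes "indep_rv N1 X N2 Y"
  shows "indep_rv N2 Y N1 X"
proof -
  have [measurable]: "random_variable N1 X" "random_variable N2 Y"
    and joint: "distr M (N1 \<Otimes>\<^sub>M N2) (\<lambda>\<omega>. (X \<omega>, Y \<omega>)) = distr M N1 X \<Otimes>\<^sub>M distr M N2 Y"
    using assms by (auto simp: indep_rv_def)
  interpret X: prob_space "distr M N1 X" by (rule prob_space_distr) simp
  interpret Y: prob_space "distr M N2 Y" by (rule prob_space_distr) simp
  interpret XY: pair_sigma_finite "distr M N2 Y" "distr M N1 X" ..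
  have "distr M (N2 \<Otimes>\<^sub>M N1) (\<lambda>\<omega>. (Y \<omega>, X \<omega>)) =
      distr (distr M (N1 \<Otimes>\<^sub>M N2) (\<lambda>\<omega>. (X \<omega>, Y \<omega>))) (N2 \<Otimes>\<^sub>M N1) (\<lambda>(x, y). (y, x))"
    by (simp add: distr_distr comp_def)
  also have "\<dots> = distr M N2 Y \<Otimes>\<^sub>M distr M N1 X"
    unfolding joint
    by (rule trans[OF distr_cong XY.distr_pair_swap[symmetric]]) (simp_all cong: sets_pair_measure_cong)
  finally show ?thesis by (simp add: indep_rv_def)
qed

text \<open>The conditioning principle. By Fubini the law of \<open>f (X, Y)\<close> is the mixture
  of the laws of \<open>f (x, Y)\<close> over the law of \<open>X\<close>, so equal mixing laws and
  equal fibre laws suffice. \<open>Y\<close> and \<open>Y'\<close> may take values in different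
  spaces.\<close>

lemma (in prob_space) indep_distr_eqI:
  assumes ind: "indep_rv N1 X N2 Y" "indep_rv N1 X' N3 Y'"
    and law: "distr M N1 X = distr M N1 X'"
    and f[measurable]: "f \<in> measurable (N1 \<Otimes>\<^sub>M N2) L"
    and g[measurable]: "g \<in> measurable (N1 \<Otimes>\<^sub>M N3) L"
    and fibre: "\<And>x. x \<in> space N1 \<Longrightarrow> distr M L (\<lambda>\<omega>. f (x, Y \<omega>)) = distr M L (\<lambda>\<omega>. g (x, Y' \<omega>))"
  shows "distr M L (\<lambda>\<omega>. f (X \<omega>, Y \<omega>)) = distr M L (\<lambda>\<omega>. g (X' \<omega>, Y' \<omega>))"
proof -
  have [measurable]: "random_variable N1 X" "random_variable N2 Y" "random_variable N1 X'"
    "random_variable N3 Y'"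
    using ind by (auto simp: indep_rv_def)
  interpret Y: prob_space "distr M N2 Y" by (rule prob_space_distr) simp
  interpret Y': prob_space "distr M N3 Y'" by (rule prob_space_distr) simp
  have joint: "distr M (N1 \<Otimes>\<^sub>M N2) (\<lambda>\<omega>. (X \<omega>, Y \<omega>)) = distr M N1 X \<Otimes>\<^sub>M distr M N2 Y"
    "distr M (N1 \<Otimes>\<^sub>M N3) (\<lambda>\<omega>. (X' \<omega>, Y' \<omega>)) = distr M N1 X' \<Otimes>\<^sub>M distr M N3 Y'"
    using ind by (auto simp: indep_rv_def)
  have pull: "distr M L (\<lambda>\<omega>. f (X \<omega>, Y \<omega>)) = distr (distr M N1 X \<Otimes>\<^sub>M distr M N2 Y) L f"
    "distr M L (\<lambda>\<omega>. g (X' \<omega>, Y' \<omega>)) = distr (distr M N1 X' \<Otimes>\<^sub>M distr M N3 Y') L g"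
    by (simp_all add: joint[symmetric] distr_distr comp_def)
  show ?thesis
    unfolding pull
  proof (rule measure_eqI)
    fix A assume "A \<in> sets (distr (distr M N1 X \<Otimes>\<^sub>M distr M N2 Y) L f)"
    then have A[measurable]: "A \<in> sets L" by simp
    \<comment> \<open>Stated for arbitrary \<open>U\<close>, \<open>V\<close>, \<open>h\<close>
      because both sides of the goal are expanded by it.\<close>
    have fubini: "emeasure (distr (distr M N1 U \<Otimes>\<^sub>M distr M N V) L h) A =
        (\<integral>\<^sup>+x. emeasure (distr M L (\<lambda>\<omega>. h (x, V \<omega>))) A \<partial>distr M N1 U)"
      if [measurable]: "random_variable N1 U" "random_variable N V" "h \<in> N1 \<Otimes>\<^sub>M N \<rightarrow>\<^sub>M L"
      for U V h N
    proof -
      interpret V: prob_space "distr M N V" by (rule prob_space_distr) simp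
      let ?Q = "distr M N1 U \<Otimes>\<^sub>M distr M N V"
      have "emeasure (distr ?Q L h) A = emeasure ?Q (h -` A \<inter> space ?Q)"
        by (rule emeasure_distr) simp_all
      also have "\<dots> = (\<integral>\<^sup>+x. emeasure (distr M N V) (Pair x -` (h -` A \<inter> space ?Q)) \<partial>distr M N1 U)"
        by (rule V.emeasure_pair_measure_alt) measurable
      also have "\<dots> = (\<integral>\<^sup>+x. emeasure (distr M L (\<lambda>\<omega>. h (x, V \<omega>))) A \<partial>distr M N1 U)"
      proof (rule nn_integral_cong)
        fix x assume "x \<in> space (distr M N1 U)"
        then have x[measurable]: "x \<in> space N1" by simp
        have "Pair x -` (h -` A \<inter> space ?Q) = (\<lambda>y. h (x, y)) -` A \<inter> space N"
          using x by (auto simp: space_pair_measure)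
        moreover have "distr M L (\<lambda>\<omega>. h (x, V \<omega>)) = distr (distr M N V) L (\<lambda>y. h (x, y))"
          by (simp add: distr_distr comp_def)
        ultimately show "emeasure (distr M N V) (Pair x -` (h -` A \<inter> space ?Q)) =
            emeasure (distr M L (\<lambda>\<omega>. h (x, V \<omega>))) A"
          by (simp add: emeasure_distr)
      qed
      finally show ?thesis .
    qed
    have "emeasure (distr (distr M N1 X \<Otimes>\<^sub>M distr M N2 Y) L f) A =
        (\<integral>\<^sup>+x. emeasure (distr M L (\<lambda>\<omega>. f (x, Y \<omega>))) A \<partial>distr M N1 X)"
      by (rule fubini) simp_all
    also have "\<dots> = (\<integral>\<^sup>+x. emeasure (distr M L (\<lambda>\<omega>. g (x, Y' \<omega>))) A \<partial>distr M N1 X')"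
      unfolding law by (rule nn_integral_cong) (simp add: fibre)
    also have "\<dots> = emeasure (distr (distr M N1 X' \<Otimes>\<^sub>M distr M N3 Y') L g) A"
      by (rule fubini[symmetric]) simp_all
    finally show "emeasure (distr (distr M N1 X \<Otimes>\<^sub>M distr M N2 Y) L f) A =
      emeasure (distr (distr M N1 X' \<Otimes>\<^sub>M distr M N3 Y') L g) A" .
  qed simp
qed

section \<open>Equality of laws under maps and pointwise limits\<close>

lemma distr_compose_cong:
  assumes law: "distr M N X = distr M N Y"
    and [measurable]: "X \<in> M \<rightarrow>\<^sub>M N" "Y \<in> M \<rightarrow>\<^sub>M N" "g \<in> N \<rightarrow>\<^sub>M L"
  shows "distr M L (\<lambda>\<omega>. g (X \<omega>)) = distr M L (\<lambda>\<omega>. g (Y \<omega>))"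
proof -
  have "distr (distr M N X) L g = distr (distr M N Y) L g" by (simp add: law)
  then show ?thesis by (simp add: distr_distr comp_def)
qed

text \<open>The integrands \<open>iexp (u * X n \<omega>)\<close> are bounded by 1, so dominated
  convergence carries equality of the characteristic functions to the limits, and these determine
  the laws.\<close>

lemma (in prob_space) distr_eq_LIMSEQ:
  fixes X Y :: "nat \<Rightarrow> 'a \<Rightarrow> real"
  assumes [measurable]: "\<And>n. random_variable borel (X n)" "\<And>n. random_variable borel (Y n)"
    "random_variable borel X'" "random_variable borel Y'"
    and law: "\<And>n. distr M borel (X n) = distr M borel (Y n)"
    and X: "\<And>\<omega>. \<omega> \<in> space M \<Longrightarrow> (\<lambda>n. X n \<omega>) \<longlonglongrightarrow> X' \<omega>"
    and Y: "\<And>\<omega>. \<omega> \<in> space M \<Longrightarrow> (\<lambda>n. Y n \<omega>) \<longlonglongrightarrow> Y' \<omega>"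
  shows "distr M borel X' = distr M borel Y'"
proof (rule Levy_uniqueness)
  show "char (distr M borel X') = char (distr M borel Y')"
  proof
    fix u
    have char: "char (distr M borel Z) u = (CLINT \<omega>|M. iexp (u * Z \<omega>))"
      if [measurable]: "random_variable borel Z" for Z
      unfolding char_def by (subst integral_distr) auto
    have lim: "(\<lambda>n. CLINT \<omega>|M. iexp (u * Z n \<omega>)) \<longlonglongrightarrow> (CLINT \<omega>|M. iexp (u * Z' \<omega>))"
      if [measurable]: "\<And>n. random_variable borel (Z n)" "random_variable borel Z'"
        and Z: "\<And>\<omega>. \<omega> \<in> space M \<Longrightarrow> (\<lambda>n. Z n \<omega>) \<longlonglongrightarrow> Z' \<omega>" for Z Z'
      by (rule integral_dominated_convergence[where w="\<lambda>_. 1"])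
        (auto intro!: tendsto_intros Z AE_I2)
    have "(CLINT \<omega>|M. iexp (u * X n \<omega>)) = (CLINT \<omega>|M. iexp (u * Y n \<omega>))" for n
      using char[of "X n"] char[of "Y n"] law[of n] by simp
    then show "char (distr M borel X') u = char (distr M borel Y') u"
      using LIMSEQ_unique[OF lim[of X X'] ] lim[of Y Y'] X Y by (simp add: char)
  qed
qed (auto intro!: real_distribution_distr)

section \<open>A process evaluated at an independent random time\<close>

text \<open>Floor plus one, unlike the ceiling, keeps \<open>q n\<close> strictly above
  \<open>t\<close> even when \<open>t\<close> is a grid point; a limit along
  \<open>at_right t\<close> requires this.\<close>

lemma discretise_from_right:
  fixes t :: real
  assumes "0 \<le> t"
  defines "q \<equiv> \<lambda>n. (real (nat \<lfloor>t * real (Suc n)\<rfloor>) + 1) / real (Suc n)"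
  shows "t < q n" "q \<longlonglongrightarrow> t"
proof -
  have b: "t < q n \<and> q n \<le> t + 1 / real (Suc n)" for n
  proof -
    have "0 \<le> \<lfloor>t * real (Suc n)\<rfloor>" using assms by simp
    then have "real (nat \<lfloor>t * real (Suc n)\<rfloor>) = of_int \<lfloor>t * real (Suc n)\<rfloor>" by simp
    then show ?thesis
      unfolding q_def by (simp add: field_simps del: of_nat_Suc) linarith
  qed
  then show "t < q n" by simp
  have "(\<lambda>n. t + 1 / real (Suc n)) \<longlonglongrightarrow> t + 0"
    by (intro tendsto_intros LIMSEQ_Suc lim_1_over_n)
  then show "q \<longlonglongrightarrow> t"
    using b by (intro real_tendsto_sandwich[of "\<lambda>_. t" q _ "\<lambda>n. t + 1 / real (Suc n)"])
      (auto intro!: always_eventually less_imp_le)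
qed

text \<open>For a time with countably many values the claim is \<open>scaling\<close> on each fibre.
  Rounding \<open>T\<close> up to finer and finer grids and using right-continuity of the paths
  extends it to general \<open>T\<close>, and gives measurability as well.\<close>

lemma (in prob_space) distr_at_random_time:
  fixes X :: "real \<Rightarrow> 'a \<Rightarrow> real" and T :: "'a \<Rightarrow> real"
  assumes ind: "indep_rv borel T (PiM {0..} (\<lambda>_. borel)) (\<lambda>\<omega>. \<lambda>t\<in>{0..}. X t \<omega>)"
    and nonneg: "\<And>\<omega>. 0 \<le> T \<omega>"
    and right_cont: "\<And>\<omega> t. \<omega> \<in> space M \<Longrightarrow> 0 \<le> t \<Longrightarrow> continuous (at_right t) (\<lambda>s. X s \<omega>)"
    and scaling: "\<And>s. 0 < s \<Longrightarrow> distr M borel (X s) = distr M borel (\<lambda>\<omega>. s * X 1 \<omega>)"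
  shows "random_variable borel (\<lambda>\<omega>. X (T \<omega>) \<omega>)"
    and "distr M borel (\<lambda>\<omega>. X (T \<omega>) \<omega>) = distr M borel (\<lambda>\<omega>. T \<omega> * X 1 \<omega>)"
proof -
  let ?P = "PiM {0..} (\<lambda>_. borel) :: (real \<Rightarrow> real) measure"
  have [measurable]: "random_variable borel T"
    using ind by (simp add: indep_rv_def)
  have path[measurable]: "random_variable ?P (\<lambda>\<omega>. \<lambda>t\<in>{0..}. X t \<omega>)"
    using ind by (simp add: indep_rv_def)
  have X[measurable]: "random_variable borel (X s)" if "0 \<le> s" for s
    using measurable_compose[OF path measurable_component_singleton[of s]] that by simp
  \<comment> \<open>\<open>k n t\<close> is the index of the cell of mesh \<open>1 / Suc n\<close>
    containing \<open>t\<close>, and \<open>q n j\<close> is the right end of cell \<open>j\<close>.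
    The index is kept separate so that conditioning is on a variable in \<open>nat\<close>.\<close>
  define k where "k n t = nat \<lfloor>t * real (Suc n)\<rfloor>" for n and t :: real
  define q where "q n j = (real j + 1) / real (Suc n)" for n j
  have [measurable]: "k n \<in> borel \<rightarrow>\<^sub>M count_space UNIV" for n
    unfolding k_def by measurable
  have q_pos: "0 < q n j" for n j by (simp add: q_def)
  have q_nonneg: "0 \<le> q n j" for n j using q_pos[of n j] by simp
  have q_gt: "T \<omega> < q n (k n (T \<omega>))" and q_lim: "(\<lambda>n. q n (k n (T \<omega>))) \<longlonglongrightarrow> T \<omega>" for n \<omega>
    using discretise_from_right[OF nonneg[of \<omega>]] by (simp_all add: q_def k_def)
  have comp: "(\<lambda>y. y s) \<in> ?P \<rightarrow>\<^sub>M borel" if "0 \<le> s" for s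
    using that by (intro measurable_component_singleton) simp
  \<comment> \<open>On each of the countably many events \<open>k n (T \<omega>) = j\<close> the map
    is the fixed-time variable \<open>X (q n j)\<close>.\<close>
  have meas: "random_variable borel (\<lambda>\<omega>. X (q n (k n (T \<omega>))) \<omega>)" for n
    by (rule measurable_compose_countable[where g="\<lambda>\<omega>. k n (T \<omega>)"]) (auto simp: q_nonneg)
  have lim: "(\<lambda>n. X (q n (k n (T \<omega>))) \<omega>) \<longlonglongrightarrow> X (T \<omega>) \<omega>" if "\<omega> \<in> space M" for \<omega>
  proof -
    have "((\<lambda>s. X s \<omega>) \<longlongrightarrow> X (T \<omega>) \<omega>) (at_right (T \<omega>))"
      using right_cont[OF that nonneg] by (simp add: continuous_within)
    moreover have "filterlim (\<lambda>n. q n (k n (T \<omega>))) (at_right (T \<omega>)) sequentially"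
      unfolding filterlim_at
      using q_lim[of \<omega>] q_gt[of \<omega>] by (auto intro!: always_eventually dest: less_imp_neq not_sym)
    ultimately show ?thesis by (rule filterlim_compose)
  qed
  show XT: "random_variable borel (\<lambda>\<omega>. X (T \<omega>) \<omega>)"
    using lim meas by (rule borel_measurable_LIMSEQ_real)
  have ind_k: "indep_rv (count_space UNIV) (\<lambda>\<omega>. k n (T \<omega>)) ?P (\<lambda>\<omega>. \<lambda>t\<in>{0..}. X t \<omega>)" for n
    by (rule indep_rv_compose[OF ind]) simp_all
  \<comment> \<open>Given the index \<open>j\<close> the time is the positive constant
    \<open>q n j\<close>, so the fibre laws agree by \<open>scaling\<close>.\<close>
  have law: "distr M borel (\<lambda>\<omega>. X (q n (k n (T \<omega>))) \<omega>) =
      distr M borel (\<lambda>\<omega>. q n (k n (T \<omega>)) * X 1 \<omega>)" for n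
    using indep_distr_eqI[OF ind_k[of n] ind_k[of n] refl,
        of "\<lambda>(j, y). y (q n j)" borel "\<lambda>(j, y). q n j * y 1"]
    by (simp add: measurable_pair_measure_countable1 comp q_nonneg scaling q_pos)
  show "distr M borel (\<lambda>\<omega>. X (T \<omega>) \<omega>) = distr M borel (\<lambda>\<omega>. T \<omega> * X 1 \<omega>)"
  proof (rule distr_eq_LIMSEQ[OF meas _ XT _ law lim])
    show "random_variable borel (\<lambda>\<omega>. q n (k n (T \<omega>)) * X 1 \<omega>)" for n
      unfolding q_def by measurable
    show "random_variable borel (\<lambda>\<omega>. T \<omega> * X 1 \<omega>)" by measurable
  qed (auto intro!: tendsto_intros q_lim)
qed

section \<open>Inversion and scaling of the Cauchy law\<close>

text \<open>Substituting \<open>x \<mapsto> 1/x\<close> multiplies by the Jacobian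
  \<open>1/x\<^sup>2\<close>, and \<open>k (1/x) / x\<^sup>2 = k x\<close>.\<close>

lemma cauchy_density_inverse:
  fixes k :: "real \<Rightarrow> real"
  defines "k \<equiv> \<lambda>x. 1 / (pi * (1 + x\<^sup>2))"
  assumes int: "integrable lborel k"
  shows "distr (density lborel k) borel inverse = density lborel k"
proof (rule measure_eqI)
  fix A :: "real set" assume "A \<in> sets (distr (density lborel k) borel inverse)"
  then have A[measurable]: "A \<in> sets borel" by simp
  have k_nonneg: "0 \<le> k x" for x by (simp add: k_def)
  have [measurable]: "k \<in> borel_measurable borel" unfolding k_def by measurable
  \<comment> \<open>The substitution rule used below concerns gauge integrals of absolutely
    integrable functions along a differentiable map. Measures are therefore written as such
    integrals over \<open>- {0}\<close>, which only drops a null set.\<close>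
  have em: "emeasure (density lborel k) B = ennreal (integral (- {0}) (\<lambda>x. indicator B x * k x))"
    and abs_int: "(\<lambda>x. indicator B x * k x) absolutely_integrable_on - {0}"
    if [measurable]: "B \<in> sets borel" for B
  proof -
    have i: "integrable lborel (\<lambda>x. indicator B x * k x)"
      using integrable_mult_indicator[OF _ int, of B] by simp
    have s: "set_integrable lborel (- {0}) (\<lambda>x. indicator B x * k x)"
      unfolding set_integrable_def by (rule integrable_mult_indicator[OF _ i]) simp
    have "(LINT x:- {0}|lborel. indicator B x * k x) = (LINT x|lborel. indicator B x * k x)"
      unfolding set_lebesgue_integral_def
      by (rule integral_cong_AE) (use AE_lborel_singleton[of 0] in \<open>auto simp: indicator_def\<close>)
    moreover have "emeasure (density lborel k) B = (\<integral>\<^sup>+x. ennreal (indicator B x * k x) \<partial>lborel)"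
      by (subst emeasure_density)
        (auto intro!: nn_integral_cong simp: indicator_def)
    moreover have "\<dots> = ennreal (LINT x|lborel. indicator B x * k x)"
      by (rule nn_integral_eq_integral[OF i]) (simp add: k_nonneg)
    ultimately show "emeasure (density lborel k) B =
        ennreal (integral (- {0}) (\<lambda>x. indicator B x * k x))"
      using set_borel_integral_eq_integral(2)[OF s] by simp
    show "(\<lambda>x. indicator B x * k x) absolutely_integrable_on - {0}"
      using s unfolding set_integrable_def by (subst integrable_completion) auto
  qed
  define f where "f x = indicator A x * k x" for x
  have img: "inverse ` (- {0}) = - {0::real}"
  proof
    show "- {0} \<subseteq> inverse ` (- {0::real})"
    proof
      fix x :: real assume "x \<in> - {0}"
      then show "x \<in> inverse ` (- {0})"
        by (intro image_eqI[of _ _ "inverse x"]) simp_all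
    qed
  qed auto
  have der: "(inverse has_field_derivative - inverse (x\<^sup>2)) (at x within - {0})"
    if "x \<in> - {0}" for x :: real
    using that DERIV_inverse[of x "- {0}"] by (simp add: power2_eq_square)
  have "integral (- {0}) (\<lambda>x. \<bar>- inverse (x\<^sup>2)\<bar> * f (inverse x)) = integral (- {0}) f"
    using has_absolute_integral_change_of_variables_1'[OF _ der, of f "integral (- {0}) f"]
      abs_int[OF A] by (simp add: img f_def[abs_def] inj_on_def)
  moreover have "\<bar>- inverse (x\<^sup>2)\<bar> * f (inverse x) = indicator (inverse -` A) x * k x" if "x \<noteq> 0" for x
    using that by (auto simp: f_def k_def indicator_def field_simps)
  ultimately have eq: "integral (- {0}) (\<lambda>x. indicator (inverse -` A) x * k x) = integral (- {0}) f"
    by (metis (no_types, lifting) Henstock_Kurzweil_Integration.integral_cong ComplD singletonI)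
  have [measurable]: "inverse -` A \<in> sets borel"
    using measurable_sets[OF borel_measurable_inverse[OF measurable_ident] A] by simp
  show "emeasure (distr (density lborel k) borel inverse) A = emeasure (density lborel k) A"
    by (subst emeasure_distr) (simp_all add: em eq f_def[abs_def])
qed simp

context cauchy_process
begin

lemma measurable_at[measurable]: "0 \<le> t \<Longrightarrow> random_variable borel (X t)"
  by (rule random_variable)

lemma distr_density:
  "0 < t \<Longrightarrow> distr M borel (X t) = density lborel (\<lambda>x. ennreal (t / (pi * (t\<^sup>2 + x\<^sup>2))))"
  using distributed_distr_eq_density[OF cauchy_law[of t]] by (simp cong: distr_cong)

text \<open>The affine density formula divides by \<open>\<bar>c\<bar>\<close>; the sign of
  \<open>c\<close> disappears because the Cauchy density is even.\<close>

lemma distr_scale: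
  assumes "c \<noteq> 0"
  shows "distr M borel (\<lambda>\<omega>. c * X 1 \<omega>) = distr M borel (X \<bar>c\<bar>)"
proof -
  have "1 / (pi * (1 + (x / c)\<^sup>2)) / \<bar>c\<bar> = \<bar>c\<bar> / (pi * (\<bar>c\<bar>\<^sup>2 + x\<^sup>2))" for x
  proof -
    have "1 + (x / c)\<^sup>2 = (c\<^sup>2 + x\<^sup>2) / c\<^sup>2" using assms by (simp add: field_simps)
    then have "1 / (pi * (1 + (x / c)\<^sup>2)) / \<bar>c\<bar> = (c\<^sup>2 / \<bar>c\<bar>) / (pi * (c\<^sup>2 + x\<^sup>2))"
      by (simp add: ac_simps)
    also have "c\<^sup>2 / \<bar>c\<bar> = \<bar>c\<bar>"
      using assms by (simp add: divide_eq_eq power2_eq_square)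
    finally show ?thesis by simp
  qed
  then have "ennreal (1 / (pi * (1 + (x / c)\<^sup>2))) / \<bar>c\<bar> = ennreal (\<bar>c\<bar> / (pi * (\<bar>c\<bar>\<^sup>2 + x\<^sup>2)))" for x
    using assms by (subst divide_ennreal) auto
  then show ?thesis
    using distributed_distr_eq_density[OF distributed_affine[OF cauchy_law[of 1] assms, of 0]] assms
    by (simp add: distr_density cong: distr_cong)
qed

lemma distr_inverse: "distr M borel (\<lambda>\<omega>. inverse (X 1 \<omega>)) = distr M borel (X 1)"
proof -
  have "emeasure (density lborel (\<lambda>x::real. ennreal (1 / (pi * (1 + x\<^sup>2))))) UNIV = 1"
    \<comment> \<open>Integrability of the density comes from its being the law of
      \<open>X 1\<close>, hence of mass 1; no arctangent integral is computed.\<close>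
    using prob_space.emeasure_space_1[OF prob_space_distr[of "X 1" borel]] distr_density[of 1] by simp
  then have "integrable lborel (\<lambda>x::real. 1 / (pi * (1 + x\<^sup>2)))"
    by (intro integrableI_nonneg) (auto simp: emeasure_density)
  from cauchy_density_inverse[OF this] show ?thesis
    using distr_density[of 1] distr_distr[of inverse borel borel "X 1" M] by (simp add: comp_def)
qed

text \<open>The form in which inversion is used: a Cauchy variable at time \<open>t\<close> may be
  replaced by \<open>t\<close> over a standard one.\<close>

lemma distr_scaled_inverse:
  assumes "0 < t"
  shows "distr M borel (\<lambda>\<omega>. t * inverse (X 1 \<omega>)) = distr M borel (X t)"
  using distr_compose_cong[OF distr_inverse, of "\<lambda>x. t * x" borel] distr_scale[of t] assms
  by simp

end

section \<open>Reduction of all three expressions to one product\<close>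

theorem mainTheorem15:
  fixes M :: "'a measure" and C1 C2 :: "real \<Rightarrow> 'a \<Rightarrow> real"
  assumes "cauchy_process M C1"
    and "cauchy_process M C2"
    and "indep_processes M C1 C2"
  shows "eq_id M (\<lambda>t \<omega>. C1 \<bar>C2 t \<omega>\<bar> \<omega>)
           (\<lambda>t \<omega>. 1 / (2 * C1 (1 / sqrt (2 * t)) \<omega> * C2 (1 / sqrt (2 * t)) \<omega>)) \<and>
         eq_id M (\<lambda>t \<omega>. C1 \<bar>C2 t \<omega>\<bar> \<omega>)
           (\<lambda>t \<omega>. 1 / C1 \<bar>C2 (1 / t) \<omega>\<bar> \<omega>)"
proof -
  interpret C1: cauchy_process M C1 by fact
  interpret C2: cauchy_process M C2 by fact
  let ?P = "PiM {0..} (\<lambda>_. borel) :: (real \<Rightarrow> real) measure"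
  \<comment> \<open>\<open>C2\<close> comes first since it supplies the random time, and
    \<open>indep_distr_eqI\<close> conditions on the first variable.\<close>
  have ind: "C1.indep_rv ?P (\<lambda>\<omega>. \<lambda>t\<in>{0..}. C2 t \<omega>) ?P (\<lambda>\<omega>. \<lambda>t\<in>{0..}. C1 t \<omega>)"
    using assms(3) unfolding indep_processes_def
    by (rule C1.indep_rv_commute[OF C1.indep_var_imp_indep_rv])
  have coord: "(\<lambda>y. h (y t)) \<in> ?P \<rightarrow>\<^sub>M borel"
    if "0 \<le> t" "h \<in> borel \<rightarrow>\<^sub>M borel" for t and h :: "real \<Rightarrow> real"
    by (rule measurable_compose[OF measurable_component_singleton]) (use that in simp_all)
  have ind_path: "C1.indep_rv borel (\<lambda>\<omega>. h (C2 t \<omega>)) ?P (\<lambda>\<omega>. \<lambda>t\<in>{0..}. C1 t \<omega>)"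
    if "0 \<le> t" "h \<in> borel \<rightarrow>\<^sub>M borel" for t and h :: "real \<Rightarrow> real"
    using C1.indep_rv_compose[OF ind coord[OF that] measurable_ident] that(1) by (simp add: id_def)
  have ind_point: "C1.indep_rv borel (\<lambda>\<omega>. h (C2 t \<omega>)) borel (\<lambda>\<omega>. g (C1 s \<omega>))"
    if "0 \<le> t" "0 \<le> s" "h \<in> borel \<rightarrow>\<^sub>M borel" "g \<in> borel \<rightarrow>\<^sub>M borel"
    for t s and h g :: "real \<Rightarrow> real"
    using C1.indep_rv_compose[OF ind coord[OF that(1,3)] coord[OF that(2,4)]] that(1,2) by simp
  have time: "C1.random_variable borel (\<lambda>\<omega>. C1 \<bar>C2 t \<omega>\<bar> \<omega>)"
    "distr M borel (\<lambda>\<omega>. C1 \<bar>C2 t \<omega>\<bar> \<omega>) = distr M borel (\<lambda>\<omega>. C2 t \<omega> * C1 1 \<omega>)" if "0 < t" for t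
  proof -
    note R = C1.distr_at_random_time[OF ind_path[of t abs]]
    have sc: "distr M borel (C1 s) = distr M borel (\<lambda>\<omega>. s * C1 1 \<omega>)" if "0 < s" for s
      using C1.distr_scale[of s] that by simp
    have rc: "continuous (at_right s) (\<lambda>s. C1 s \<omega>)" if "\<omega> \<in> space M" "0 \<le> s" for \<omega> s
      using C1.cadlag_paths[OF that(1)] that(2) by (simp add: cadlag_def)
    show "C1.random_variable borel (\<lambda>\<omega>. C1 \<bar>C2 t \<omega>\<bar> \<omega>)"
      using R(1) sc rc that by simp
    \<comment> \<open>Symmetry of \<open>C1 1\<close> removes the absolute value;
      \<open>x = 0\<close> is separate because \<open>distr_scale\<close> needs a nonzero
      factor.\<close>
    have "distr M borel (\<lambda>\<omega>. \<bar>x\<bar> * C1 1 \<omega>) = distr M borel (\<lambda>\<omega>. x * C1 1 \<omega>)" for x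
      using C1.distr_scale[of x] C1.distr_scale[of "\<bar>x\<bar>"] by (cases "x = 0") simp_all
    then have "distr M borel (\<lambda>\<omega>. \<bar>C2 t \<omega>\<bar> * C1 1 \<omega>) = distr M borel (\<lambda>\<omega>. C2 t \<omega> * C1 1 \<omega>)"
      using C1.indep_distr_eqI[OF ind_point[of t 1 "\<lambda>x. x" "\<lambda>x. x"] ind_point[of t 1 "\<lambda>x. x" "\<lambda>x. x"],
          of "\<lambda>(x, y). \<bar>x\<bar> * y" borel "\<lambda>(x, y). x * y"] that by simp
    then show "distr M borel (\<lambda>\<omega>. C1 \<bar>C2 t \<omega>\<bar> \<omega>) = distr M borel (\<lambda>\<omega>. C2 t \<omega> * C1 1 \<omega>)"
      using R(2) sc rc that by simp
  qed
  \<comment> \<open>Replaces both independent coordinates by scaled reciprocals at once, inside any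
    measurable \<open>f\<close>; taking \<open>f\<close> to be a reciprocal of a product turns it
    back into a product.\<close>
  have pair: "distr M borel (\<lambda>\<omega>. f (C2 t \<omega>, C1 s \<omega>)) =
      distr M borel (\<lambda>\<omega>. f (t * inverse (C2 1 \<omega>), s * inverse (C1 1 \<omega>)))"
    if t: "0 < t" "0 < s" and [measurable]: "f \<in> borel \<Otimes>\<^sub>M borel \<rightarrow>\<^sub>M borel"
    for t s and f :: "real \<times> real \<Rightarrow> real"
  proof (rule C1.indep_distr_eqI)
    show "C1.indep_rv borel (C2 t) borel (C1 s)"
      by (rule ind_point) (use t in simp_all)
    show "C1.indep_rv borel (\<lambda>\<omega>. t * inverse (C2 1 \<omega>)) borel (\<lambda>\<omega>. s * inverse (C1 1 \<omega>))"
      by (rule ind_point) simp_all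
    show "distr M borel (C2 t) = distr M borel (\<lambda>\<omega>. t * inverse (C2 1 \<omega>))"
      using C2.distr_scaled_inverse[OF t(1)] by (rule sym)
    show "distr M borel (\<lambda>\<omega>. f (x, C1 s \<omega>)) = distr M borel (\<lambda>\<omega>. f (x, s * inverse (C1 1 \<omega>)))" for x
      by (rule distr_compose_cong[OF C1.distr_scaled_inverse[OF t(2), symmetric]]) (use t in simp_all)
  qed fact+
  have scale2: "distr M borel (\<lambda>\<omega>. C2 t \<omega> * C1 1 \<omega>) = distr M borel (\<lambda>\<omega>. t * C2 1 \<omega> * C1 1 \<omega>)"
    if "0 < t" for t
  proof -
    have "distr M borel (\<lambda>\<omega>. (\<lambda>(x, y). x * y) (C2 t \<omega>, C1 1 \<omega>)) =
        distr M borel (\<lambda>\<omega>. (\<lambda>(x, y). x * y) (t * C2 1 \<omega>, C1 1 \<omega>))"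
    proof (rule C1.indep_distr_eqI)
      show "C1.indep_rv borel (C2 t) borel (C1 1)"
        by (rule ind_point) (use that in simp_all)
      show "C1.indep_rv borel (\<lambda>\<omega>. t * C2 1 \<omega>) borel (C1 1)"
        by (rule ind_point) simp_all
      show "distr M borel (C2 t) = distr M borel (\<lambda>\<omega>. t * C2 1 \<omega>)"
        using C2.distr_scale[of t] that by simp
    qed simp_all
    then show ?thesis by simp
  qed
  show ?thesis
    unfolding eq_id_def
  proof (intro conjI allI impI)
    fix t :: real assume t: "0 < t"
    \<comment> \<open>The two factors \<open>a\<close> and the constant 2 combine to
      \<open>2 * a * a = 1 / t\<close>, whose reciprocal is the required factor
      \<open>t\<close>.\<close>
    define a where "a = 1 / sqrt (2 * t)"
    have a: "0 < a" "2 * a * a = 1 / t"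
      using t by (simp_all add: a_def field_simps)
    note [measurable] = time(1)
    show "C1.random_variable borel (\<lambda>\<omega>. C1 \<bar>C2 t \<omega>\<bar> \<omega>)"
      "C1.random_variable borel (\<lambda>\<omega>. C1 \<bar>C2 t \<omega>\<bar> \<omega>)"
      using t by (rule time(1))+
    show "C1.random_variable borel (\<lambda>\<omega>. 1 / (2 * C1 (1 / sqrt (2 * t)) \<omega> * C2 (1 / sqrt (2 * t)) \<omega>))"
      "C1.random_variable borel (\<lambda>\<omega>. 1 / C1 \<bar>C2 (1 / t) \<omega>\<bar> \<omega>)"
      using t by simp_all
    \<comment> \<open>No case distinction is needed: with \<open>inverse 0 = 0\<close> and
      \<open>1 / 0 = 0\<close> both sides vanish when \<open>x\<close> or \<open>y\<close> is
      0.\<close>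
    have "1 / (2 * (a * inverse y) * (a * inverse x)) = t * x * y" for x y
    proof -
      have "1 / (2 * (a * inverse y) * (a * inverse x)) = 1 / (2 * a * a) * x * y"
        by (simp add: field_simps)
      then show ?thesis by (simp add: a(2))
    qed
    then show "distr M borel (\<lambda>\<omega>. C1 \<bar>C2 t \<omega>\<bar> \<omega>) =
        distr M borel (\<lambda>\<omega>. 1 / (2 * C1 (1 / sqrt (2 * t)) \<omega> * C2 (1 / sqrt (2 * t)) \<omega>))"
      using pair[OF a(1) a(1), of "\<lambda>(x, y). 1 / (2 * y * x)"] time(2)[OF t] scale2[OF t]
      unfolding a_def[symmetric] by simp
    \<comment> \<open>The reciprocal is applied to the product law at time \<open>1 / t\<close>;
      \<open>pair\<close> then inverts both factors, and \<open>1 / t\<close> becomes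
      \<open>t\<close>.\<close>
    have "distr M borel (\<lambda>\<omega>. 1 / C1 \<bar>C2 (1 / t) \<omega>\<bar> \<omega>) = distr M borel (\<lambda>\<omega>. 1 / (C2 (1 / t) \<omega> * C1 1 \<omega>))"
      by (rule distr_compose_cong[OF time(2)]) (use t time(1) in simp_all)
    also have "\<dots> = distr M borel (\<lambda>\<omega>. t * C2 1 \<omega> * C1 1 \<omega>)"
      using pair[of "1 / t" 1 "\<lambda>(x, y). 1 / (x * y)"] t by (simp add: field_simps)
    finally show "distr M borel (\<lambda>\<omega>. C1 \<bar>C2 t \<omega>\<bar> \<omega>) = distr M borel (\<lambda>\<omega>. 1 / C1 \<bar>C2 (1 / t) \<omega>\<bar> \<omega>)"
      using time(2)[OF t] scale2[OF t] by simp
  qed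
qed

end
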